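(* Let $R$ be a $\ast$-ring (associative, with unity). The following statements are equivalent: (1) $R$ is symmetric. (2) For all $a,b,c\in R$, $abc\in R^{\mathrm{EP}}$ implies $acb\in R^{\mathrm{EP}}$.
   Context: A $\ast$-ring is an associative ring with unity equipped with an involution, i.e. a map $a\mapsto a^{\ast}$ with $(a^{\ast})^{\ast}=a$, $(a+b)^{\ast}=a^{\ast}+b^{\ast}$, $(ab)^{\ast}=b^{\ast}a^{\ast}$. A ring $R$ is symmetric if, for all $a,b,c\in R$, $abc=0$ implies $acb=0$. An element $a\in R$ is group invertible if there is a (necessarily unique) $x=a^{\sharp}\in R$ with $axa=a$, $xax=x$, $ax=xa$; $R^{\sharp}$ is the set of group invertible elements. An element $a\in R$ is Moore-Penrose invertible if there is a (necessarily unique) $x=a^{\dag}\in R$ with $axa=a$, $xax=x$, $(ax)^{\ast}=ax$, $(xa)^{\ast}=xa$; $R^{\dag}$ is the set of Moore-Penrose invertible elements. An element $a$ is EP if $a\in R^{\sharp}\cap R^{\dag}$ and $a^{\sharp}=a^{\dag}$; $R^{\mathrm{EP}}$ is the set of EP elements of $R$. *)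

theory Defs
  imports Main
begin

text \<open>
  The sort \<open>{ring, monoid_mult}\<close> is that of associative, not necessarily commutative rings with
  unity. Unlike \<open>ring_1\<close> it does not demand \<open>0 \<noteq> 1\<close>, so the zero ring is included.
\<close>

definition is_involution :: "('a::{ring, monoid_mult} \<Rightarrow> 'a) \<Rightarrow> bool" where
  "is_involution star \<longleftrightarrow>
     (\<forall>a. star (star a) = a) \<and>
     (\<forall>a b. star (a + b) = star a + star b) \<and>
     (\<forall>a b. star (a * b) = star b * star a)"

definition symmetric_ring :: "'a::{ring, monoid_mult} itself \<Rightarrow> bool" where
  "symmetric_ring _ \<longleftrightarrow> (\<forall>a b c :: 'a. a * b * c = 0 \<longrightarrow> a * c * b = 0)"

definition is_group_inverse :: "'a::{ring, monoid_mult} \<Rightarrow> 'a \<Rightarrow> bool" where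
  "is_group_inverse a x \<longleftrightarrow> a * x * a = a \<and> x * a * x = x \<and> a * x = x * a"

definition group_invertible :: "'a::{ring, monoid_mult} set" where
  "group_invertible = {a. \<exists>x. is_group_inverse a x}"

text \<open>
  The two inverses below are unique whenever they exist (for the second one, if \<open>star\<close> is an
  involution), but are unspecified outside the respective sets of invertible elements.
\<close>

definition group_inverse :: "'a::{ring, monoid_mult} \<Rightarrow> 'a" where
  "group_inverse a = (THE x. is_group_inverse a x)"

definition is_MP_inverse :: "('a::{ring, monoid_mult} \<Rightarrow> 'a) \<Rightarrow> 'a \<Rightarrow> 'a \<Rightarrow> bool" where
  "is_MP_inverse star a x \<longleftrightarrow>
     a * x * a = a \<and> x * a * x = x \<and> star (a * x) = a * x \<and> star (x * a) = x * a"

definition MP_invertible :: "('a::{ring, monoid_mult} \<Rightarrow> 'a) \<Rightarrow> 'a set" where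
  "MP_invertible star = {a. \<exists>x. is_MP_inverse star a x}"

definition MP_inverse :: "('a::{ring, monoid_mult} \<Rightarrow> 'a) \<Rightarrow> 'a \<Rightarrow> 'a" where
  "MP_inverse star a = (THE x. is_MP_inverse star a x)"

definition EP_elements :: "('a::{ring, monoid_mult} \<Rightarrow> 'a) \<Rightarrow> 'a set" where
  "EP_elements star =
     {a \<in> group_invertible \<inter> MP_invertible star. group_inverse a = MP_inverse star a}"

lemma group_inverse_unique:
  fixes a :: "'a::{ring, monoid_mult}"
  assumes "is_group_inverse a x" "is_group_inverse a y"
  shows "x = y"
proof -
  have x: "a * x * a = a" "x * a * x = x" "a * x = x * a"
    and y: "a * y * a = a" "y * a * y = y" "a * y = y * a"
    using assms unfolding is_group_inverse_def by blast+
  have "y * a = (y * a) * (x * a)"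
    using x(1) by (simp add: mult.assoc)
  also have "\<dots> = (a * y) * (a * x)"
    by (simp only: x(3) y(3))
  also have "\<dots> = a * x"
    using y(1) by (simp add: mult.assoc[symmetric])
  finally have "x * a = y * a"
    by (simp only: x(3))
  then show ?thesis
    by (metis x(2,3) y(2,3) mult.assoc)
qed

lemma group_inverse_eq:
  "is_group_inverse a x \<Longrightarrow> group_inverse a = x"
  unfolding group_inverse_def using group_inverse_unique by blast

lemma MP_inverse_unique:
  fixes a :: "'a::{ring, monoid_mult}"
  assumes "is_involution star" "is_MP_inverse star a x" "is_MP_inverse star a y"
  shows "x = y"
proof -
  have s: "star (b * c) = star c * star b" for b c
    using assms(1) by (simp add: is_involution_def)
  have x: "a * x * a = a" "x * a * x = x" "star (a * x) = a * x" "star (x * a) = x * a"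
    and y: "a * y * a = a" "y * a * y = y" "star (a * y) = a * y" "star (y * a) = y * a"
    using assms(2,3) unfolding is_MP_inverse_def by blast+
  have "a * x = star ((a * y) * (a * x))"
    using x(3) y(1) by (simp add: mult.assoc[symmetric])
  also have "\<dots> = (a * x) * (a * y)"
    by (simp only: s[of "a * y" "a * x"] x(3) y(3))
  also have "\<dots> = a * y"
    using x(1) by (simp add: mult.assoc[symmetric])
  finally have l: "a * x = a * y" .
  have "x * a = star ((x * a) * (y * a))"
    using x(4) y(1) by (simp add: mult.assoc)
  also have "\<dots> = (y * a) * (x * a)"
    by (simp only: s[of "x * a" "y * a"] x(4) y(4))
  also have "\<dots> = y * a"
    using x(1) by (simp add: mult.assoc)
  finally have r: "x * a = y * a" .
  show ?thesis
    by (metis l r x(2) y(2) mult.assoc)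
qed

lemma MP_inverse_eq:
  "is_involution star \<Longrightarrow> is_MP_inverse star a x \<Longrightarrow> MP_inverse star a = x"
  unfolding MP_inverse_def using MP_inverse_unique by blast

end

theory Submission imports Defs begin

text \<open>
  An element \<open>x\<close> is EP exactly when it has a group inverse \<open>y\<close> whose idempotent \<open>x * y\<close> is
  fixed by the involution.

  If the ring is symmetric, its idempotents are central, so the idempotent \<open>p\<close> belonging to an EP
  element \<open>a * b * c\<close> splits the ring into two factors. In the factor belonging to \<open>1 - p\<close> the
  product \<open>a * b * c\<close> vanishes, hence so does \<open>a * c * b\<close> by symmetry. In the factor belonging to \<open>p\<close>
  the product \<open>a * b * c\<close> is a unit; a ring with central idempotents is Dedekind finite, so each of
  \<open>a\<close>, \<open>b\<close>, \<open>c\<close> is a unit there, and therefore \<open>a * c * b\<close> is one too. Thus \<open>a * c * b\<close> has a group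
  inverse belonging to the same \<open>p\<close>, and it is EP.

  Conversely, assume that swapping the last two factors preserves EP products. Note that \<open>0\<close> is EP and group invertible elements of square zero vanish. If \<open>b * c = 0\<close>, then
  \<open>c * b\<close> is EP as well and has square zero, so \<open>c * b = 0\<close>: the ring is reversible. In a reversible
  ring any factors may be inserted into a product that is zero, so \<open>a * b * c = 0\<close> makes the square of
  \<open>a * c * b\<close> vanish. Since \<open>a * c * b\<close> is EP too, it is zero.
\<close>

section \<open>EP elements through their idempotents\<close>

lemma EP_elements_iff:
  fixes star :: "'a::{ring, monoid_mult} \<Rightarrow> 'a"
  assumes "is_involution star"
  shows "a \<in> EP_elements star \<longleftrightarrow> (\<exists>x. is_group_inverse a x \<and> star (a * x) = a * x)"
proof
  assume "a \<in> EP_elements star"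
  then obtain x y where x: "is_group_inverse a x" and y: "is_MP_inverse star a y"
    and eq: "group_inverse a = MP_inverse star a"
    by (auto simp: EP_elements_def group_invertible_def MP_invertible_def)
  have "x = y"
    using eq group_inverse_eq[OF x] MP_inverse_eq[OF assms y] by simp
  with x y show "\<exists>x. is_group_inverse a x \<and> star (a * x) = a * x"
    by (auto simp: is_MP_inverse_def)
next
  assume "\<exists>x. is_group_inverse a x \<and> star (a * x) = a * x"
  then obtain x where x: "is_group_inverse a x" and "star (a * x) = a * x"
    by blast
  then have y: "is_MP_inverse star a x"
    unfolding is_group_inverse_def is_MP_inverse_def by metis
  show "a \<in> EP_elements star"
    using x y group_inverse_eq[OF x] MP_inverse_eq[OF assms y]
    by (auto simp: EP_elements_def group_invertible_def MP_invertible_def)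
qed

lemma zero_in_EP_elements:
  fixes star :: "'a::{ring, monoid_mult} \<Rightarrow> 'a"
  assumes "is_involution star"
  shows "0 \<in> EP_elements star"
proof -
  have "star (0 + 0) = star 0 + star 0"
    using assms unfolding is_involution_def by blast
  then have "star 0 = 0"
    by simp
  then show ?thesis
    unfolding EP_elements_iff[OF assms] by (intro exI[of _ 0]) (simp add: is_group_inverse_def)
qed

lemma group_invertible_square_zero:
  fixes a :: "'a::{ring, monoid_mult}"
  assumes "a \<in> group_invertible" "a * a = 0"
  shows "a = 0"
proof -
  obtain x where "a * x * a = a" "a * x = x * a"
    using assms(1) by (auto simp: group_invertible_def is_group_inverse_def)
  then have "a = x * (a * a)"
    by (simp add: mult.assoc)
  then show ?thesis
    using assms(2) by simp
qed

section \<open>Idempotents of symmetric rings\<close>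

text \<open>
  Symmetry applied to \<open>p * (1 - p) * r = 0\<close> and to \<open>(1 - p) * p * r = 0\<close> shows that both \<open>p * r\<close> and
  \<open>r * p\<close> equal \<open>p * r * p\<close>.
\<close>

lemma symmetric_ring_idempotent_central:
  fixes p r :: "'a::{ring, monoid_mult}"
  assumes "symmetric_ring TYPE('a)" "p * p = p"
  shows "p * r = r * p"
proof -
  have sym: "a * b * c = 0 \<Longrightarrow> a * c * b = 0" for a b c :: 'a
    using assms(1) by (simp add: symmetric_ring_def)
  have "p * r * (1 - p) = 0" "(1 - p) * r * p = 0"
    by (rule sym, simp add: algebra_simps assms(2))+
  then have "p * r = p * r * p" "r * p = p * r * p"
    by (simp_all add: left_diff_distrib right_diff_distrib)
  then show ?thesis
    by metis
qed

text \<open>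
  Dedekind finiteness of the corner ring with unit \<open>p\<close>: the product \<open>p * (v * u)\<close> in the reverse order
  is again idempotent, hence central, and so can be moved out of \<open>p = u * (p * (v * u)) * v\<close>.
\<close>

lemma symmetric_ring_corner_commute:
  fixes p u v :: "'a::{ring, monoid_mult}"
  assumes sym: "symmetric_ring TYPE('a)" and idem: "p * p = p" and uv: "p * (u * v) = p"
  shows "p * (v * u) = p"
proof -
  note central = symmetric_ring_idempotent_central[OF sym]
  define q where "q = p * (v * u)"
  have q_alt: "q = v * p * u"
    by (simp add: q_def central[OF idem, of v] mult.assoc[symmetric])
  have "q * q = v * (p * (u * v)) * p * u"
    unfolding q_alt by (metis central[OF idem] mult.assoc)
  also have "\<dots> = q"
    by (simp add: uv q_alt idem mult.assoc)
  finally have idem_q: "q * q = q" .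
  have "p = p * (u * v) * (p * (u * v))"
    by (simp add: uv idem)
  also have "\<dots> = p * (u * q * v)"
    unfolding q_alt by (metis central[OF idem] idem mult.assoc)
  also have "\<dots> = q * (p * (u * v))"
    by (metis central[OF idem_q] mult.assoc)
  also have "\<dots> = q"
    by (metis uv central[OF idem] idem q_def mult.assoc)
  finally show ?thesis
    by (simp add: q_def)
qed

text \<open>
  By Dedekind finiteness, the cyclic rotations of \<open>p * (a * b * c * y) = p\<close> hold as well. They exhibit
  right inverses of \<open>a\<close>, \<open>b\<close> and \<open>c\<close> modulo \<open>1 - p\<close>, which are multiplied in the order that
  inverts \<open>a * c * b\<close>.
\<close>

lemma symmetric_ring_corner_swap:
  fixes p a b c y :: "'a::{ring, monoid_mult}"
  assumes sym: "symmetric_ring TYPE('a)" and idem: "p * p = p" and abc: "p * (a * b * c * y) = p"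
  obtains z where "p * (a * c * b * z) = p"
proof
  note central = symmetric_ring_idempotent_central[OF sym idem]
  note comm = symmetric_ring_corner_commute[OF sym idem]
  have a: "p * (a * (b * c * y)) = p"
    using abc by (simp add: mult.assoc)
  have b: "p * (b * (c * y * a)) = p"
    using comm[OF a] by (simp add: mult.assoc)
  have c: "p * (c * (y * a * b)) = p"
    using comm[OF b] by (simp add: mult.assoc)
  have "p * (a * c * b * ((c * y * a) * (y * a * b) * (b * c * y)))
      = a * c * (p * (b * (c * y * a))) * (y * a * b) * (b * c * y)"
    by (metis central mult.assoc)
  also have "\<dots> = a * (p * (c * (y * a * b))) * (b * c * y)"
    unfolding b by (metis central mult.assoc)
  also have "\<dots> = p * (a * (b * c * y))"
    unfolding c by (metis central mult.assoc)
  finally show "p * (a * c * b * ((c * y * a) * (y * a * b) * (b * c * y))) = p"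
    using a by simp
qed

lemma symmetric_ring_corner_group_inverse:
  fixes p w z :: "'a::{ring, monoid_mult}"
  assumes sym: "symmetric_ring TYPE('a)" and idem: "p * p = p"
    and pw: "p * w = w" and wz: "p * (w * z) = p"
  shows "is_group_inverse w (p * z)" "w * (p * z) = p"
proof -
  note central = symmetric_ring_idempotent_central[OF sym idem]
  have zw: "p * (z * w) = p"
    by (rule symmetric_ring_corner_commute[OF sym idem wz])
  show right: "w * (p * z) = p"
    by (metis central wz mult.assoc)
  have left: "p * z * w = p"
    using zw by (simp add: mult.assoc)
  show "is_group_inverse w (p * z)"
    unfolding is_group_inverse_def right left
    by (simp add: pw idem mult.assoc[symmetric])
qed

lemma symmetric_ring_EP_swap:
  fixes star :: "'a::{ring, monoid_mult} \<Rightarrow> 'a"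
  assumes inv: "is_involution star" and sym: "symmetric_ring TYPE('a)"
    and EP: "a * b * c \<in> EP_elements star"
  shows "a * c * b \<in> EP_elements star"
proof -
  obtain y where y: "is_group_inverse (a * b * c) y"
    and star: "star (a * b * c * y) = a * b * c * y"
    using EP by (auto simp: EP_elements_iff[OF inv])
  define p where "p = a * b * c * y"
  have p_abc: "p * (a * b * c) = a * b * c"
    using y unfolding is_group_inverse_def p_def by blast
  have idem: "p * p = p"
    using p_abc by (metis p_def mult.assoc)
  have "p * (a * b * c * y) = p"
    using idem by (simp add: p_def)
  then obtain z where z: "p * (a * c * b * z) = p"
    by (rule symmetric_ring_corner_swap[OF sym idem])
  have "(1 - p) * a * b * c = 0"
    using p_abc by (simp add: algebra_simps)
  then have "(1 - p) * a * c * b = 0"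
    using sym unfolding symmetric_ring_def by blast
  then have "p * (a * c * b) = a * c * b"
    by (simp add: algebra_simps)
  note inverse = symmetric_ring_corner_group_inverse[OF sym idem this z]
  have "star p = p"
    using star by (simp add: p_def)
  then show ?thesis
    unfolding EP_elements_iff[OF inv] using inverse by auto
qed

section \<open>Reversible rings\<close>

lemma reversible_insert:
  fixes u v r :: "'a::{ring, monoid_mult}"
  assumes reversible: "\<And>b c :: 'a. b * c = 0 \<Longrightarrow> c * b = 0" and "u * v = 0"
  shows "u * r * v = 0"
proof -
  have "v * (u * r) = 0"
    using reversible[OF assms(2)] by (simp add: mult.assoc[symmetric])
  then show ?thesis
    by (rule reversible)
qed

text \<open>
  The square \<open>a * c * b * a * c * b\<close> contains \<open>a\<close>, \<open>b\<close>, \<open>c\<close> in this order, as its first, third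
  and fifth factors.
\<close>

lemma reversible_swap_square_zero:
  fixes a b c :: "'a::{ring, monoid_mult}"
  assumes reversible: "\<And>b c :: 'a. b * c = 0 \<Longrightarrow> c * b = 0" and "a * b * c = 0"
  shows "(a * c * b) * (a * c * b) = 0"
proof -
  have "a * (b * c) = 0"
    using assms(2) by (simp add: mult.assoc)
  then have "a * c * (b * c) = 0"
    using reversible_insert[OF reversible] by blast
  then have "(a * c * b) * c = 0"
    by (simp add: mult.assoc)
  then have "(a * c * b) * a * c = 0"
    using reversible_insert[OF reversible] by blast
  then show ?thesis
    by (simp add: mult.assoc[symmetric])
qed

lemma EP_swap_imp_symmetric_ring:
  fixes star :: "'a::{ring, monoid_mult} \<Rightarrow> 'a"
  assumes inv: "is_involution star"
    and swap: "\<And>a b c :: 'a. a * b * c \<in> EP_elements star \<Longrightarrow> a * c * b \<in> EP_elements star"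
  shows "symmetric_ring TYPE('a)"
proof -
  have vanish: "a * c * b = 0"
    if "a * b * c = 0" "(a * c * b) * (a * c * b) = 0" for a b c :: 'a
  proof (rule group_invertible_square_zero)
    show "a * c * b \<in> group_invertible"
      using swap[of a b c] that(1) zero_in_EP_elements[OF inv] by (simp add: EP_elements_def)
  qed (fact that(2))
  have reversible: "c * b = 0" if "b * c = 0" for b c :: 'a
  proof -
    have "(c * b) * (c * b) = c * (b * c) * b"
      by (simp add: mult.assoc)
    then show ?thesis
      using vanish[of 1 b c] that by simp
  qed
  show ?thesis
    unfolding symmetric_ring_def
    using vanish reversible_swap_square_zero[OF reversible] by blast
qed

theorem theorem3p6:
  fixes star :: "'a::{ring, monoid_mult} \<Rightarrow> 'a"
  assumes "is_involution star"
  shows "symmetric_ring TYPE('a) \<longleftrightarrow>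
    (\<forall>a b c :: 'a. a * b * c \<in> EP_elements star \<longrightarrow> a * c * b \<in> EP_elements star)"
  using symmetric_ring_EP_swap[OF assms] EP_swap_imp_symmetric_ring[OF assms] by blast

end
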